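(* (3D divergence-free construction.) Let $\Delta x,\Delta y,\Delta z>0$ and let arbitrary real coefficients $\widetilde B^{m(\ell)}_{ijk},\ A^{m(\ell)}_{ijk}$ ($m=1,2,3$; $\ell=1,\dots,10$; $(i,j,k)\in\mathbb Z^3$) be given. Let $\mathbf B^h=(B^{h,1},B^{h,2},B^{h,3})$ be the piecewise polynomial field on the Cartesian mesh $\{\mathcal T_{ijk}\}$ obtained from these data by the 3D divergence-free construction defined in the context. Then: (1) on every element $\mathcal T_{ijk}$ the pointwise divergence of $\mathbf B^h$ is constant and equal to $$\nabla\cdot\mathbf B^h\big|_{\mathcal T_{ijk}}=\frac{b^{1(1)}_{i+\frac12\,j\,k}-b^{1(1)}_{i-\frac12\,j\,k}}{\Delta x}+\frac{b^{2(1)}_{i\,j+\frac12\,k}-b^{2(1)}_{i\,j-\frac12\,k}}{\Delta y}+\frac{b^{3(1)}_{i\,j\,k+\frac12}-b^{3(1)}_{i\,j\,k-\frac12}}{\Delta z},$$ and this constant is $0$; (2) the normal component of $\mathbf B^h$ is continuous across every element face: on each face orthogonal to the $m$-th coordinate direction, the traces of $B^{h,m}$ from the two adjacent elements coincide (both equal the face polynomial $b^m$), $m=1,2,3$. That is, $\mathbf B^h$ is globally divergence-free.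
   Context: Mesh: uniform Cartesian elements $\mathcal T_{ijk}$ with centers $(x_i,y_j,z_k)$, widths $\Delta x,\Delta y,\Delta z$, and local coordinates $(\xi,\eta,\zeta)\in[-1,1]^3$ given by $x=x_i+\xi\Delta x/2$, $y=y_j+\eta\Delta y/2$, $z=z_k+\zeta\Delta z/2$. Data are indexed by $(i,j,k)\in\mathbb Z^3$ (on a bounded mesh, data are extended by boundary conditions, e.g. periodically). The face between $\mathcal T_{i-1\,jk}$ and $\mathcal T_{ijk}$ has index $(i-\frac12,j,k)$, and similarly in the other two directions. 3D basis $\varphi^{(\ell)}(\xi,\eta,\zeta)$: $\varphi^{(1)}=1$, $\varphi^{(2)}=\sqrt3\xi$, $\varphi^{(3)}=\sqrt3\eta$, $\varphi^{(4)}=\sqrt3\zeta$, $\varphi^{(5)}=3\xi\eta$, $\varphi^{(6)}=3\xi\zeta$, $\varphi^{(7)}=3\eta\zeta$, $\varphi^{(8)}=\frac{\sqrt5}2(3\xi^2-1)$, $\varphi^{(9)}=\frac{\sqrt5}2(3\eta^2-1)$, $\varphi^{(10)}=\frac{\sqrt5}2(3\zeta^2-1)$, $\varphi^{(11)}=\frac{\sqrt{15}}2\eta(3\xi^2-1)$, $\varphi^{(12)}=\frac{\sqrt{15}}2\zeta(3\xi^2-1)$, $\varphi^{(13)}=\frac{\sqrt{15}}2\xi(3\eta^2-1)$, $\varphi^{(14)}=\frac{\sqrt{15}}2\zeta(3\eta^2-1)$, $\varphi^{(15)}=\frac{\sqrt{15}}2\xi(3\zeta^2-1)$, $\varphi^{(16)}=\frac{\sqrt{15}}2\eta(3\zeta^2-1)$,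 $\varphi^{(17)}=3\sqrt3\,\xi\eta\zeta$, $\varphi^{(18)}=\frac{\sqrt7}2(5\xi^3-3\xi)$, $\varphi^{(19)}=\frac{\sqrt7}2(5\eta^3-3\eta)$, $\varphi^{(20)}=\frac{\sqrt7}2(5\zeta^3-3\zeta)$. 2D face basis $\varphi_{2D}^{(\ell)}(\alpha,\beta)$, $\ell=1,\dots,6$: $1,\ \sqrt3\alpha,\ \sqrt3\beta,\ 3\alpha\beta,\ \frac{\sqrt5}2(3\alpha^2-1),\ \frac{\sqrt5}2(3\beta^2-1)$. The input is the predicted magnetic field with components $\sum_{\ell=1}^{10}\widetilde B^{m(\ell)}_{ijk}\varphi^{(\ell)}$ and the vector potential with components $\sum_{\ell=1}^{10}A^{m(\ell)}_{ijk}\varphi^{(\ell)}$ on $\mathcal T_{ijk}$, $m=1,2,3$. Construction. Step 1 (edge-averaged potentials): $\mathcal A^1_{i\,j-\frac12\,k-\frac12}=\frac18\sum_{\ell=1}^{10}\int_{-1}^1\big[A^{1(\ell)}_{ijk}\varphi^{(\ell)}(\xi,-1,-1)+A^{1(\ell)}_{ij\,k-1}\varphi^{(\ell)}(\xi,-1,1)+A^{1(\ell)}_{i\,j-1\,k}\varphi^{(\ell)}(\xi,1,-1)+A^{1(\ell)}_{i\,j-1\,k-1}\varphi^{(\ell)}(\xi,1,1)\big]d\xi$, $\mathcal A^2_{i-\frac12\,j\,k-\frac12}=\frac18\sum_{\ell=1}^{10}\int_{-1}^1\big[A^{2(\ell)}_{ijk}\varphi^{(\ell)}(-1,\eta,-1)+A^{2(\ell)}_{ij\,k-1}\varphi^{(\ell)}(-1,\eta,1)+A^{2(\ell)}_{i-1\,jk}\varphi^{(\ell)}(1,\eta,-1)+A^{2(\ell)}_{i-1\,j\,k-1}\varphi^{(\ell)}(1,\eta,1)\big]d\eta$,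 $\mathcal A^3_{i-\frac12\,j-\frac12\,k}=\frac18\sum_{\ell=1}^{10}\int_{-1}^1\big[A^{3(\ell)}_{ijk}\varphi^{(\ell)}(-1,-1,\zeta)+A^{3(\ell)}_{i\,j-1\,k}\varphi^{(\ell)}(-1,1,\zeta)+A^{3(\ell)}_{i-1\,jk}\varphi^{(\ell)}(1,-1,\zeta)+A^{3(\ell)}_{i-1\,j-1\,k}\varphi^{(\ell)}(1,1,\zeta)\big]d\zeta$. Step 2 (face polynomials): $b^1_{i-\frac12\,jk}=\sum_{\ell=1}^6b^{1(\ell)}_{i-\frac12\,jk}\varphi_{2D}^{(\ell)}(\eta,\zeta)$, $b^2_{i\,j-\frac12\,k}=\sum_{\ell=1}^6b^{2(\ell)}_{i\,j-\frac12\,k}\varphi_{2D}^{(\ell)}(\xi,\zeta)$, $b^3_{ij\,k-\frac12}=\sum_{\ell=1}^6b^{3(\ell)}_{ij\,k-\frac12}\varphi_{2D}^{(\ell)}(\xi,\eta)$, where: $b^{1(1)}_{i-\frac12\,jk}=\frac1{\Delta y}(\mathcal A^3_{i-\frac12\,j+\frac12\,k}-\mathcal A^3_{i-\frac12\,j-\frac12\,k})-\frac1{\Delta z}(\mathcal A^2_{i-\frac12\,j\,k+\frac12}-\mathcal A^2_{i-\frac12\,j\,k-\frac12})$; $b^{1(2)}_{i-\frac12\,jk}=\frac12(\widetilde B^{1(3)}_{i-1\,jk}+\sqrt3\widetilde B^{1(5)}_{i-1\,jk}+\widetilde B^{1(3)}_{ijk}-\sqrt3\widetilde B^{1(5)}_{ijk})$;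 $b^{1(3)}_{i-\frac12\,jk}=\frac12(\widetilde B^{1(4)}_{i-1\,jk}+\sqrt3\widetilde B^{1(6)}_{i-1\,jk}+\widetilde B^{1(4)}_{ijk}-\sqrt3\widetilde B^{1(6)}_{ijk})$; $b^{1(4)},b^{1(5)},b^{1(6)}$ at $(i-\frac12,j,k)$ equal $\frac12(\widetilde B^{1(p)}_{i-1\,jk}+\widetilde B^{1(p)}_{ijk})$ with $p=7,9,10$ respectively. $b^{2(1)}_{i\,j-\frac12\,k}=\frac1{\Delta z}(\mathcal A^1_{i\,j-\frac12\,k+\frac12}-\mathcal A^1_{i\,j-\frac12\,k-\frac12})-\frac1{\Delta x}(\mathcal A^3_{i+\frac12\,j-\frac12\,k}-\mathcal A^3_{i-\frac12\,j-\frac12\,k})$; $b^{2(2)}_{i\,j-\frac12\,k}=\frac12(\widetilde B^{2(2)}_{i\,j-1\,k}+\sqrt3\widetilde B^{2(5)}_{i\,j-1\,k}+\widetilde B^{2(2)}_{ijk}-\sqrt3\widetilde B^{2(5)}_{ijk})$; $b^{2(3)}_{i\,j-\frac12\,k}=\frac12(\widetilde B^{2(4)}_{i\,j-1\,k}+\sqrt3\widetilde B^{2(7)}_{i\,j-1\,k}+\widetilde B^{2(4)}_{ijk}-\sqrt3\widetilde B^{2(7)}_{ijk})$; $b^{2(4)},b^{2(5)},b^{2(6)}$ at $(i,j-\frac12,k)$ equal $\frac12(\widetilde B^{2(p)}_{i\,j-1\,k}+\widetilde B^{2(p)}_{ijk})$ with $p=6,8,10$ respectively. $b^{3(1)}_{ij\,k-\frac12}=\frac1{\Delta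 x}(\mathcal A^2_{i+\frac12\,j\,k-\frac12}-\mathcal A^2_{i-\frac12\,j\,k-\frac12})-\frac1{\Delta y}(\mathcal A^1_{i\,j+\frac12\,k-\frac12}-\mathcal A^1_{i\,j-\frac12\,k-\frac12})$; $b^{3(2)}_{ij\,k-\frac12}=\frac12(\widetilde B^{3(2)}_{ij\,k-1}+\sqrt3\widetilde B^{3(6)}_{ij\,k-1}+\widetilde B^{3(2)}_{ijk}-\sqrt3\widetilde B^{3(6)}_{ijk})$; $b^{3(3)}_{ij\,k-\frac12}=\frac12(\widetilde B^{3(3)}_{ij\,k-1}+\sqrt3\widetilde B^{3(7)}_{ij\,k-1}+\widetilde B^{3(3)}_{ijk}-\sqrt3\widetilde B^{3(7)}_{ijk})$; $b^{3(4)},b^{3(5)},b^{3(6)}$ at $(i,j,k-\frac12)$ equal $\frac12(\widetilde B^{3(p)}_{ij\,k-1}+\widetilde B^{3(p)}_{ijk})$ with $p=5,8,9$ respectively. Step 3 (element field): $B^{h,m}|_{\mathcal T_{ijk}}=\sum_{\ell=1}^{20}B^{m(\ell)}_{ijk}\varphi^{(\ell)}(\xi,\eta,\zeta)$, $m=1,2,3$. Fix $(i,j,k)$ and for each $\ell$ write $S_1^{(\ell)}=b^{1(\ell)}_{i+\frac12\,jk}+b^{1(\ell)}_{i-\frac12\,jk}$, $D_1^{(\ell)}=b^{1(\ell)}_{i+\frac12\,jk}-b^{1(\ell)}_{i-\frac12\,jk}$, $S_2^{(\ell)}=b^{2(\ell)}_{i\,j+\frac12\,k}+b^{2(\ell)}_{i\,j-\frac12\,k}$,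 $D_2^{(\ell)}=b^{2(\ell)}_{i\,j+\frac12\,k}-b^{2(\ell)}_{i\,j-\frac12\,k}$, $S_3^{(\ell)}=b^{3(\ell)}_{ij\,k+\frac12}+b^{3(\ell)}_{ij\,k-\frac12}$, $D_3^{(\ell)}=b^{3(\ell)}_{ij\,k+\frac12}-b^{3(\ell)}_{ij\,k-\frac12}$. 1-component: $B^{1(1)}=\frac12S_1^{(1)}+\frac1{2\sqrt3}\big(\frac{\Delta x}{\Delta y}D_2^{(2)}+\frac{\Delta x}{\Delta z}D_3^{(2)}\big)$; $B^{1(2)}=\frac1{2\sqrt3}D_1^{(1)}+\frac1{2\sqrt{15}}\big(\frac{\Delta x}{\Delta y}D_2^{(5)}+\frac{\Delta x}{\Delta z}D_3^{(5)}\big)$; $B^{1(3)}=\frac12S_1^{(2)}+\frac1{2\sqrt3}\frac{\Delta x}{\Delta z}D_3^{(4)}$; $B^{1(4)}=\frac12S_1^{(3)}+\frac1{2\sqrt3}\frac{\Delta x}{\Delta y}D_2^{(4)}$; $B^{1(5)}=\frac1{2\sqrt3}D_1^{(2)}$; $B^{1(6)}=\frac1{2\sqrt3}D_1^{(3)}$; $B^{1(7)}=\frac12S_1^{(4)}$; $B^{1(8)}=-\frac1{2\sqrt{15}}\big(\frac{\Delta x}{\Delta y}D_2^{(2)}+\frac{\Delta x}{\Delta z}D_3^{(2)}\big)$; $B^{1(9)}=\frac12S_1^{(5)}$; $B^{1(10)}=\frac12S_1^{(6)}$; $B^{1(11)}=-\frac1{2\sqrt{15}}\frac{\Delta x}{\Delta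 z}D_3^{(4)}$; $B^{1(12)}=-\frac1{2\sqrt{15}}\frac{\Delta x}{\Delta y}D_2^{(4)}$; $B^{1(13)}=\frac1{2\sqrt3}D_1^{(5)}$; $B^{1(14)}=0$; $B^{1(15)}=\frac1{2\sqrt3}D_1^{(6)}$; $B^{1(16)}=0$; $B^{1(17)}=\frac1{2\sqrt3}D_1^{(4)}$; $B^{1(18)}=-\frac1{2\sqrt{35}}\big(\frac{\Delta x}{\Delta y}D_2^{(5)}+\frac{\Delta x}{\Delta z}D_3^{(5)}\big)$; $B^{1(19)}=B^{1(20)}=0$. 2-component: $B^{2(1)}=\frac12S_2^{(1)}+\frac1{2\sqrt3}\big(\frac{\Delta y}{\Delta x}D_1^{(2)}+\frac{\Delta y}{\Delta z}D_3^{(3)}\big)$; $B^{2(2)}=\frac12S_2^{(2)}$; $B^{2(3)}=\frac1{2\sqrt3}D_2^{(1)}+\frac1{2\sqrt{15}}\big(\frac{\Delta y}{\Delta x}D_1^{(5)}+\frac{\Delta y}{\Delta z}D_3^{(6)}\big)$; $B^{2(4)}=\frac12S_2^{(3)}+\frac1{2\sqrt3}\frac{\Delta y}{\Delta x}D_1^{(4)}$; $B^{2(5)}=\frac1{2\sqrt3}D_2^{(2)}$; $B^{2(6)}=\frac12S_2^{(4)}$; $B^{2(7)}=\frac1{2\sqrt3}D_2^{(3)}$; $B^{2(8)}=\frac12S_2^{(5)}$; $B^{2(9)}=-\frac1{2\sqrt{15}}\big(\frac{\Delta y}{\Delta x}D_1^{(2)}+\frac{\Delta y}{\Delta z}D_3^{(3)}\big)$;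 $B^{2(10)}=\frac12S_2^{(6)}$; $B^{2(11)}=\frac1{2\sqrt3}D_2^{(5)}$; $B^{2(12)}=B^{2(13)}=0$; $B^{2(14)}=-\frac1{2\sqrt{15}}\frac{\Delta y}{\Delta x}D_1^{(4)}$; $B^{2(15)}=0$; $B^{2(16)}=\frac1{2\sqrt3}D_2^{(6)}$; $B^{2(17)}=\frac1{2\sqrt3}D_2^{(4)}$; $B^{2(18)}=0$; $B^{2(19)}=-\frac1{2\sqrt{35}}\big(\frac{\Delta y}{\Delta x}D_1^{(5)}+\frac{\Delta y}{\Delta z}D_3^{(6)}\big)$; $B^{2(20)}=0$. 3-component: $B^{3(1)}=\frac12S_3^{(1)}+\frac1{2\sqrt3}\big(\frac{\Delta z}{\Delta x}D_1^{(3)}+\frac{\Delta z}{\Delta y}D_2^{(3)}\big)$; $B^{3(2)}=\frac12S_3^{(2)}$; $B^{3(3)}=\frac12S_3^{(3)}$; $B^{3(4)}=\frac1{2\sqrt3}D_3^{(1)}+\frac1{2\sqrt{15}}\big(\frac{\Delta z}{\Delta x}D_1^{(6)}+\frac{\Delta z}{\Delta y}D_2^{(6)}\big)$; $B^{3(5)}=\frac12S_3^{(4)}$; $B^{3(6)}=\frac1{2\sqrt3}D_3^{(2)}$; $B^{3(7)}=\frac1{2\sqrt3}D_3^{(3)}$; $B^{3(8)}=\frac12S_3^{(5)}$; $B^{3(9)}=\frac12S_3^{(6)}$; $B^{3(10)}=-\frac1{2\sqrt{15}}\big(\frac{\Delta z}{\Delta x}D_1^{(3)}+\frac{\Delta z}{\Delta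 y}D_2^{(3)}\big)$; $B^{3(11)}=0$; $B^{3(12)}=\frac1{2\sqrt3}D_3^{(5)}$; $B^{3(13)}=0$; $B^{3(14)}=\frac1{2\sqrt3}D_3^{(6)}$; $B^{3(15)}=B^{3(16)}=0$; $B^{3(17)}=\frac1{2\sqrt3}D_3^{(4)}$; $B^{3(18)}=B^{3(19)}=0$; $B^{3(20)}=-\frac1{2\sqrt{35}}\big(\frac{\Delta z}{\Delta x}D_1^{(6)}+\frac{\Delta z}{\Delta y}D_2^{(6)}\big)$. *)

theory Defs
  imports "HOL-Analysis.Analysis"
begin

text \<open>
  Index conventions. Elements are indexed by \<open>(i, j, k)\<close>, a triple of integers. A half-integer
  index is represented by rounding it up: the face with index \<open>(i - 1/2, j, k)\<close> is stored at
  \<open>i j k\<close> (so \<open>(i + 1/2, j, k)\<close> is stored at \<open>(i + 1) j k\<close>), and the edge with index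
  \<open>(i, j - 1/2, k - 1/2)\<close> is stored at \<open>i j k\<close>; likewise in the other directions.
  Components and coordinate directions are elements of the type \<open>3\<close>; basis functions are
  numbered from \<open>1\<close>, and only the indices occurring in the sums below are meaningful.
\<close>

type_synonym coeffs = "3 \<Rightarrow> nat \<Rightarrow> int \<Rightarrow> int \<Rightarrow> int \<Rightarrow> real"

definition center :: "real \<Rightarrow> real \<Rightarrow> real \<Rightarrow> real^3 \<Rightarrow> int \<Rightarrow> int \<Rightarrow> int \<Rightarrow> real^3" where
  "center dx dy dz orig i j k = orig + vector [of_int i * dx, of_int j * dy, of_int k * dz]"

definition element :: "real \<Rightarrow> real \<Rightarrow> real \<Rightarrow> real^3 \<Rightarrow> int \<Rightarrow> int \<Rightarrow> int \<Rightarrow> (real^3) set" where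
  "element dx dy dz orig i j k =
     cbox (center dx dy dz orig i j k - vector [dx / 2, dy / 2, dz / 2])
          (center dx dy dz orig i j k + vector [dx / 2, dy / 2, dz / 2])"

definition local_coord ::
  "real \<Rightarrow> real \<Rightarrow> real \<Rightarrow> real^3 \<Rightarrow> int \<Rightarrow> int \<Rightarrow> int \<Rightarrow> real^3 \<Rightarrow> real^3" where
  "local_coord dx dy dz orig i j k p =
     (let c = center dx dy dz orig i j k
      in vector [(p $ 1 - c $ 1) / (dx / 2), (p $ 2 - c $ 2) / (dy / 2), (p $ 3 - c $ 3) / (dz / 2)])"

definition phi :: "nat \<Rightarrow> real \<Rightarrow> real \<Rightarrow> real \<Rightarrow> real" where
  "phi l \<xi> \<eta> \<zeta> =
    [1,
     sqrt 3 * \<xi>,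
     sqrt 3 * \<eta>,
     sqrt 3 * \<zeta>,
     3 * \<xi> * \<eta>,
     3 * \<xi> * \<zeta>,
     3 * \<eta> * \<zeta>,
     sqrt 5 / 2 * (3 * \<xi>^2 - 1),
     sqrt 5 / 2 * (3 * \<eta>^2 - 1),
     sqrt 5 / 2 * (3 * \<zeta>^2 - 1),
     sqrt 15 / 2 * \<eta> * (3 * \<xi>^2 - 1),
     sqrt 15 / 2 * \<zeta> * (3 * \<xi>^2 - 1),
     sqrt 15 / 2 * \<xi> * (3 * \<eta>^2 - 1),
     sqrt 15 / 2 * \<zeta> * (3 * \<eta>^2 - 1),
     sqrt 15 / 2 * \<xi> * (3 * \<zeta>^2 - 1),
     sqrt 15 / 2 * \<eta> * (3 * \<zeta>^2 - 1),
     3 * sqrt 3 * \<xi> * \<eta> * \<zeta>,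
     sqrt 7 / 2 * (5 * \<xi>^3 - 3 * \<xi>),
     sqrt 7 / 2 * (5 * \<eta>^3 - 3 * \<eta>),
     sqrt 7 / 2 * (5 * \<zeta>^3 - 3 * \<zeta>)] ! (l - 1)"

definition phi2D :: "nat \<Rightarrow> real \<Rightarrow> real \<Rightarrow> real" where
  "phi2D l \<alpha> \<beta> =
    [1,
     sqrt 3 * \<alpha>,
     sqrt 3 * \<beta>,
     3 * \<alpha> * \<beta>,
     sqrt 5 / 2 * (3 * \<alpha>^2 - 1),
     sqrt 5 / 2 * (3 * \<beta>^2 - 1)] ! (l - 1)"

definition edge_potential1 :: "coeffs \<Rightarrow> int \<Rightarrow> int \<Rightarrow> int \<Rightarrow> real" where
  "edge_potential1 A i j k =
     1 / 8 * (\<Sum>l = 1..10. integral {-1..1} (\<lambda>\<xi>.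
         A 1 l i j k * phi l \<xi> (-1) (-1)
       + A 1 l i j (k - 1) * phi l \<xi> (-1) 1
       + A 1 l i (j - 1) k * phi l \<xi> 1 (-1)
       + A 1 l i (j - 1) (k - 1) * phi l \<xi> 1 1))"

definition edge_potential2 :: "coeffs \<Rightarrow> int \<Rightarrow> int \<Rightarrow> int \<Rightarrow> real" where
  "edge_potential2 A i j k =
     1 / 8 * (\<Sum>l = 1..10. integral {-1..1} (\<lambda>\<eta>.
         A 2 l i j k * phi l (-1) \<eta> (-1)
       + A 2 l i j (k - 1) * phi l (-1) \<eta> 1
       + A 2 l (i - 1) j k * phi l 1 \<eta> (-1)
       + A 2 l (i - 1) j (k - 1) * phi l 1 \<eta> 1))"

definition edge_potential3 :: "coeffs \<Rightarrow> int \<Rightarrow> int \<Rightarrow> int \<Rightarrow> real" where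
  "edge_potential3 A i j k =
     1 / 8 * (\<Sum>l = 1..10. integral {-1..1} (\<lambda>\<zeta>.
         A 3 l i j k * phi l (-1) (-1) \<zeta>
       + A 3 l i (j - 1) k * phi l (-1) 1 \<zeta>
       + A 3 l (i - 1) j k * phi l 1 (-1) \<zeta>
       + A 3 l (i - 1) (j - 1) k * phi l 1 1 \<zeta>))"

definition face_coeff1 ::
  "real \<Rightarrow> real \<Rightarrow> real \<Rightarrow> coeffs \<Rightarrow> coeffs \<Rightarrow> nat \<Rightarrow> int \<Rightarrow> int \<Rightarrow> int \<Rightarrow> real" where
  "face_coeff1 dx dy dz A Bt l i j k =
    [1 / dy * (edge_potential3 A i (j + 1) k - edge_potential3 A i j k)
       - 1 / dz * (edge_potential2 A i j (k + 1) - edge_potential2 A i j k),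
     1 / 2 * (Bt 1 3 (i - 1) j k + sqrt 3 * Bt 1 5 (i - 1) j k + Bt 1 3 i j k - sqrt 3 * Bt 1 5 i j k),
     1 / 2 * (Bt 1 4 (i - 1) j k + sqrt 3 * Bt 1 6 (i - 1) j k + Bt 1 4 i j k - sqrt 3 * Bt 1 6 i j k),
     1 / 2 * (Bt 1 7 (i - 1) j k + Bt 1 7 i j k),
     1 / 2 * (Bt 1 9 (i - 1) j k + Bt 1 9 i j k),
     1 / 2 * (Bt 1 10 (i - 1) j k + Bt 1 10 i j k)] ! (l - 1)"

definition face_coeff2 ::
  "real \<Rightarrow> real \<Rightarrow> real \<Rightarrow> coeffs \<Rightarrow> coeffs \<Rightarrow> nat \<Rightarrow> int \<Rightarrow> int \<Rightarrow> int \<Rightarrow> real" where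
  "face_coeff2 dx dy dz A Bt l i j k =
    [1 / dz * (edge_potential1 A i j (k + 1) - edge_potential1 A i j k)
       - 1 / dx * (edge_potential3 A (i + 1) j k - edge_potential3 A i j k),
     1 / 2 * (Bt 2 2 i (j - 1) k + sqrt 3 * Bt 2 5 i (j - 1) k + Bt 2 2 i j k - sqrt 3 * Bt 2 5 i j k),
     1 / 2 * (Bt 2 4 i (j - 1) k + sqrt 3 * Bt 2 7 i (j - 1) k + Bt 2 4 i j k - sqrt 3 * Bt 2 7 i j k),
     1 / 2 * (Bt 2 6 i (j - 1) k + Bt 2 6 i j k),
     1 / 2 * (Bt 2 8 i (j - 1) k + Bt 2 8 i j k),
     1 / 2 * (Bt 2 10 i (j - 1) k + Bt 2 10 i j k)] ! (l - 1)"

definition face_coeff3 ::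
  "real \<Rightarrow> real \<Rightarrow> real \<Rightarrow> coeffs \<Rightarrow> coeffs \<Rightarrow> nat \<Rightarrow> int \<Rightarrow> int \<Rightarrow> int \<Rightarrow> real" where
  "face_coeff3 dx dy dz A Bt l i j k =
    [1 / dx * (edge_potential2 A (i + 1) j k - edge_potential2 A i j k)
       - 1 / dy * (edge_potential1 A i (j + 1) k - edge_potential1 A i j k),
     1 / 2 * (Bt 3 2 i j (k - 1) + sqrt 3 * Bt 3 6 i j (k - 1) + Bt 3 2 i j k - sqrt 3 * Bt 3 6 i j k),
     1 / 2 * (Bt 3 3 i j (k - 1) + sqrt 3 * Bt 3 7 i j (k - 1) + Bt 3 3 i j k - sqrt 3 * Bt 3 7 i j k),
     1 / 2 * (Bt 3 5 i j (k - 1) + Bt 3 5 i j k),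
     1 / 2 * (Bt 3 8 i j (k - 1) + Bt 3 8 i j k),
     1 / 2 * (Bt 3 9 i j (k - 1) + Bt 3 9 i j k)] ! (l - 1)"

definition face_coeff :: "real \<Rightarrow> real \<Rightarrow> real \<Rightarrow> coeffs \<Rightarrow> coeffs \<Rightarrow> coeffs" where
  "face_coeff dx dy dz A Bt m =
     (if m = 1 then face_coeff1 dx dy dz A Bt
      else if m = 2 then face_coeff2 dx dy dz A Bt
      else face_coeff3 dx dy dz A Bt)"

text \<open>
  The face polynomials, as functions of the physical point. On the face stored at \<open>i j k\<close> the
  tangential local coordinates of the two adjacent elements agree, so those of the element
  \<open>(i, j, k)\<close> are used.
\<close>

definition face_poly ::
  "real \<Rightarrow> real \<Rightarrow> real \<Rightarrow> real^3 \<Rightarrow> coeffs \<Rightarrow> coeffs \<Rightarrow> 3 \<Rightarrow> int \<Rightarrow> int \<Rightarrow> int \<Rightarrow> real^3 \<Rightarrow> real" where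
  "face_poly dx dy dz orig A Bt m i j k p =
     (let q = local_coord dx dy dz orig i j k p
      in \<Sum>l = 1..6. face_coeff dx dy dz A Bt m l i j k *
           (if m = 1 then phi2D l (q $ 2) (q $ 3)
            else if m = 2 then phi2D l (q $ 1) (q $ 3)
            else phi2D l (q $ 1) (q $ 2)))"

definition face_sum :: "coeffs \<Rightarrow> int \<Rightarrow> int \<Rightarrow> int \<Rightarrow> 3 \<Rightarrow> nat \<Rightarrow> real" where
  "face_sum b i j k m l =
     (if m = 1 then b 1 l (i + 1) j k + b 1 l i j k
      else if m = 2 then b 2 l i (j + 1) k + b 2 l i j k
      else b 3 l i j (k + 1) + b 3 l i j k)"

definition face_diff :: "coeffs \<Rightarrow> int \<Rightarrow> int \<Rightarrow> int \<Rightarrow> 3 \<Rightarrow> nat \<Rightarrow> real" where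
  "face_diff b i j k m l =
     (if m = 1 then b 1 l (i + 1) j k - b 1 l i j k
      else if m = 2 then b 2 l i (j + 1) k - b 2 l i j k
      else b 3 l i j (k + 1) - b 3 l i j k)"

text \<open>
  The element coefficients in terms of the sums \<open>S m l\<close> and differences \<open>D m l\<close> of the face
  coefficients on opposite faces of the element.
\<close>

definition elem_coeff1 ::
  "real \<Rightarrow> real \<Rightarrow> real \<Rightarrow> (3 \<Rightarrow> nat \<Rightarrow> real) \<Rightarrow> (3 \<Rightarrow> nat \<Rightarrow> real) \<Rightarrow> nat \<Rightarrow> real" where
  "elem_coeff1 dx dy dz S D l =
    [1 / 2 * S 1 1 + 1 / (2 * sqrt 3) * (dx / dy * D 2 2 + dx / dz * D 3 2),
     1 / (2 * sqrt 3) * D 1 1 + 1 / (2 * sqrt 15) * (dx / dy * D 2 5 + dx / dz * D 3 5),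
     1 / 2 * S 1 2 + 1 / (2 * sqrt 3) * (dx / dz) * D 3 4,
     1 / 2 * S 1 3 + 1 / (2 * sqrt 3) * (dx / dy) * D 2 4,
     1 / (2 * sqrt 3) * D 1 2,
     1 / (2 * sqrt 3) * D 1 3,
     1 / 2 * S 1 4,
     - 1 / (2 * sqrt 15) * (dx / dy * D 2 2 + dx / dz * D 3 2),
     1 / 2 * S 1 5,
     1 / 2 * S 1 6,
     - 1 / (2 * sqrt 15) * (dx / dz) * D 3 4,
     - 1 / (2 * sqrt 15) * (dx / dy) * D 2 4,
     1 / (2 * sqrt 3) * D 1 5,
     0,
     1 / (2 * sqrt 3) * D 1 6,
     0,
     1 / (2 * sqrt 3) * D 1 4,
     - 1 / (2 * sqrt 35) * (dx / dy * D 2 5 + dx / dz * D 3 5),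
     0,
     0] ! (l - 1)"

definition elem_coeff2 ::
  "real \<Rightarrow> real \<Rightarrow> real \<Rightarrow> (3 \<Rightarrow> nat \<Rightarrow> real) \<Rightarrow> (3 \<Rightarrow> nat \<Rightarrow> real) \<Rightarrow> nat \<Rightarrow> real" where
  "elem_coeff2 dx dy dz S D l =
    [1 / 2 * S 2 1 + 1 / (2 * sqrt 3) * (dy / dx * D 1 2 + dy / dz * D 3 3),
     1 / 2 * S 2 2,
     1 / (2 * sqrt 3) * D 2 1 + 1 / (2 * sqrt 15) * (dy / dx * D 1 5 + dy / dz * D 3 6),
     1 / 2 * S 2 3 + 1 / (2 * sqrt 3) * (dy / dx) * D 1 4,
     1 / (2 * sqrt 3) * D 2 2,
     1 / 2 * S 2 4,
     1 / (2 * sqrt 3) * D 2 3,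
     1 / 2 * S 2 5,
     - 1 / (2 * sqrt 15) * (dy / dx * D 1 2 + dy / dz * D 3 3),
     1 / 2 * S 2 6,
     1 / (2 * sqrt 3) * D 2 5,
     0,
     0,
     - 1 / (2 * sqrt 15) * (dy / dx) * D 1 4,
     0,
     1 / (2 * sqrt 3) * D 2 6,
     1 / (2 * sqrt 3) * D 2 4,
     0,
     - 1 / (2 * sqrt 35) * (dy / dx * D 1 5 + dy / dz * D 3 6),
     0] ! (l - 1)"

definition elem_coeff3 ::
  "real \<Rightarrow> real \<Rightarrow> real \<Rightarrow> (3 \<Rightarrow> nat \<Rightarrow> real) \<Rightarrow> (3 \<Rightarrow> nat \<Rightarrow> real) \<Rightarrow> nat \<Rightarrow> real" where
  "elem_coeff3 dx dy dz S D l =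
    [1 / 2 * S 3 1 + 1 / (2 * sqrt 3) * (dz / dx * D 1 3 + dz / dy * D 2 3),
     1 / 2 * S 3 2,
     1 / 2 * S 3 3,
     1 / (2 * sqrt 3) * D 3 1 + 1 / (2 * sqrt 15) * (dz / dx * D 1 6 + dz / dy * D 2 6),
     1 / 2 * S 3 4,
     1 / (2 * sqrt 3) * D 3 2,
     1 / (2 * sqrt 3) * D 3 3,
     1 / 2 * S 3 5,
     1 / 2 * S 3 6,
     - 1 / (2 * sqrt 15) * (dz / dx * D 1 3 + dz / dy * D 2 3),
     0,
     1 / (2 * sqrt 3) * D 3 5,
     0,
     1 / (2 * sqrt 3) * D 3 6,
     0,
     0,
     1 / (2 * sqrt 3) * D 3 4,
     0,
     0,
     - 1 / (2 * sqrt 35) * (dz / dx * D 1 6 + dz / dy * D 2 6)] ! (l - 1)"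

definition elem_coeff :: "real \<Rightarrow> real \<Rightarrow> real \<Rightarrow> coeffs \<Rightarrow> coeffs \<Rightarrow> coeffs" where
  "elem_coeff dx dy dz A Bt m l i j k =
     (let b = face_coeff dx dy dz A Bt; S = face_sum b i j k; D = face_diff b i j k
      in if m = 1 then elem_coeff1 dx dy dz S D l
         else if m = 2 then elem_coeff2 dx dy dz S D l
         else elem_coeff3 dx dy dz S D l)"

text \<open>
  The polynomial field of the element \<open>(i, j, k)\<close>, in physical coordinates and extended
  polynomially to the whole space. Keeping one polynomial per element makes the two traces on a
  face well defined.
\<close>

definition elem_field ::
  "real \<Rightarrow> real \<Rightarrow> real \<Rightarrow> real^3 \<Rightarrow> coeffs \<Rightarrow> coeffs \<Rightarrow> int \<Rightarrow> int \<Rightarrow> int \<Rightarrow> real^3 \<Rightarrow> real^3" where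
  "elem_field dx dy dz orig A Bt i j k p =
     (let q = local_coord dx dy dz orig i j k p
      in \<chi> m. \<Sum>l = 1..20. elem_coeff dx dy dz A Bt m l i j k * phi l (q $ 1) (q $ 2) (q $ 3))"

definition divergence :: "(real^'n \<Rightarrow> real^'n) \<Rightarrow> real^'n \<Rightarrow> real" where
  "divergence F p = (\<Sum>m\<in>UNIV. frechet_derivative F (at p) (axis m 1) $ m)"

definition globally_divergence_free ::
  "(int \<Rightarrow> int \<Rightarrow> int \<Rightarrow> (real^3) set) \<Rightarrow> (int \<Rightarrow> int \<Rightarrow> int \<Rightarrow> real^3 \<Rightarrow> real^3) \<Rightarrow> bool" where
  "globally_divergence_free T F \<longleftrightarrow>
     (\<forall>i j k. \<forall>p\<in>T i j k. F i j k differentiable (at p) \<and> divergence (F i j k) p = 0) \<and>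
     (\<forall>i j k. \<forall>p\<in>T (i - 1) j k \<inter> T i j k. F (i - 1) j k p $ 1 = F i j k p $ 1) \<and>
     (\<forall>i j k. \<forall>p\<in>T i (j - 1) k \<inter> T i j k. F i (j - 1) k p $ 2 = F i j k p $ 2) \<and>
     (\<forall>i j k. \<forall>p\<in>T i j (k - 1) \<inter> T i j k. F i j (k - 1) p $ 3 = F i j k p $ 3)"

end

theory Submission
  imports Defs
begin

text \<open>
  In local coordinates, each component of the element field is the linear interpolant, in its own
  normal direction, of the face polynomials on the two opposite faces, plus bubble terms that vanish
  on both of these faces (\<open>elem_poly1\<close>, \<open>elem_poly2\<close>, \<open>elem_poly3\<close>). This gives the second
  claim at once: the trace on a face is the face polynomial, whichever side it is taken from.

  The interpolants alone contribute to the divergence the jumps of the three face polynomials across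
  the element, each divided by a mesh width. The bubbles are built to remove everything but the
  means of these jumps. The part of a jump that depends on the first tangential variable has zero
  mean in that variable, because its basis functions are Legendre polynomials there; so it has an
  antiderivative vanishing at \<open>\<plusminus>1\<close>, and a negative multiple of this antiderivative is a bubble that can
  be added to the first tangential component without changing its normal traces. The part depending on the second
  tangential variable alone goes to the second tangential component in the same way
  (\<open>bubble_deriv_cancel\<close>). What remains of the divergence is the constant in the first claim
  (\<open>divergence_elem_field\<close>).

  Times the volume of the element, that constant is the net flux through the boundary of the element. The flux
  through a face is the circulation of the edge potentials along its boundary, and every edge of the
  element belongs to two faces, with opposite orientations; so the sum is zero
  (\<open>face_mean_flux_zero\<close>).
\<close>

section \<open>Face polynomials and bubbles\<close>

definition face_eval :: "(nat \<Rightarrow> real) \<Rightarrow> real \<Rightarrow> real \<Rightarrow> real" where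
  "face_eval c \<alpha> \<beta> = (\<Sum>l = 1..6. c l * phi2D l \<alpha> \<beta>)"

text \<open>
  Minus one half of the antiderivative in \<open>\<alpha>\<close>, vanishing at \<open>\<alpha> = \<plusminus>1\<close>, of those terms of
  \<open>face_eval c\<close> that depend on \<open>\<alpha>\<close>. The one half is the ratio between the local derivative of the
  interpolant and the jump it interpolates.
\<close>

definition bubble_fst :: "(nat \<Rightarrow> real) \<Rightarrow> real \<Rightarrow> real \<Rightarrow> real" where
  "bubble_fst c \<alpha> \<beta> = (1 - \<alpha>^2) / 4 * (sqrt 3 * c 2 + 3 * \<beta> * c 4 + sqrt 5 * \<alpha> * c 5)"

text \<open>
  The same for the terms that depend on \<open>\<beta>\<close> alone; the mixed term \<open>3 * \<alpha> * \<beta>\<close> is already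
  accounted for in \<open>bubble_fst\<close>.
\<close>

definition bubble_snd :: "(nat \<Rightarrow> real) \<Rightarrow> real \<Rightarrow> real" where
  "bubble_snd c \<beta> = (1 - \<beta>^2) / 4 * (sqrt 3 * c 3 + sqrt 5 * \<beta> * c 6)"

lemma face_eval_expand:
  "face_eval c \<alpha> \<beta> = c 1 + sqrt 3 * \<alpha> * c 2 + sqrt 3 * \<beta> * c 3 + 3 * \<alpha> * \<beta> * c 4
     + sqrt 5 / 2 * (3 * \<alpha>^2 - 1) * c 5 + sqrt 5 / 2 * (3 * \<beta>^2 - 1) * c 6"
  by (simp add: face_eval_def phi2D_def eval_nat_numeral sum.nat_ivl_Suc' algebra_simps)

text \<open>
  Rewriting every radical as a rational multiple of products of \<open>sqrt 3\<close>, \<open>sqrt 5\<close> and \<open>sqrt 7\<close> in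
  numerators turns the identities for the element polynomials into plain polynomial identities.
\<close>

lemma radical_inverses:
  "1 / (2 * sqrt 3) = sqrt 3 / 6"
  "1 / (2 * sqrt 15) = sqrt 3 * sqrt 5 / 30" "- 1 / (2 * sqrt 15) = - (sqrt 3 * sqrt 5 / 30)"
  "1 / (2 * sqrt 35) = sqrt 5 * sqrt 7 / 70" "- 1 / (2 * sqrt 35) = - (sqrt 5 * sqrt 7 / 70)"
  and sqrt_15: "sqrt 15 = sqrt 3 * sqrt 5"
proof -
  have "sqrt 35 = sqrt 5 * sqrt 7"
    by (simp flip: real_sqrt_mult)
  moreover show "sqrt 15 = sqrt 3 * sqrt 5"
    by (simp flip: real_sqrt_mult)
  ultimately show "1 / (2 * sqrt 3) = sqrt 3 / 6"
    "1 / (2 * sqrt 15) = sqrt 3 * sqrt 5 / 30" "- 1 / (2 * sqrt 15) = - (sqrt 3 * sqrt 5 / 30)"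
    "1 / (2 * sqrt 35) = sqrt 5 * sqrt 7 / 70" "- 1 / (2 * sqrt 35) = - (sqrt 5 * sqrt 7 / 70)"
    by (simp_all add: field_simps)
qed

lemma sqrt_mult_cancel: "sqrt 3 * (sqrt 3 * x) = 3 * x" "sqrt 5 * (sqrt 5 * x) = 5 * x"
  "sqrt 7 * (sqrt 7 * x) = 7 * x"
  by (simp_all flip: mult.assoc)

lemma sum_1_20: "(\<Sum>l = 1..20. f l) = f 1 + f 2 + f 3 + f 4 + f 5 + f 6 + f 7 + f 8 + f 9 + f 10
    + f 11 + f 12 + f 13 + f 14 + f 15 + f 16 + f 17 + f 18 + f 19 + f (20::nat)" for f :: "nat \<Rightarrow> real"
  by (simp add: eval_nat_numeral sum.nat_ivl_Suc')

text \<open>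
  The jumps in the other two directions enter with the ratio of the mesh widths, since the derivative
  of the bubble is to be divided by the width of its own direction but must cancel a term divided by
  the width of the direction of the jump.

  Which bubble occurs depends on the position of the normal variable of the component among the two
  variables of the face: \<open>\<xi>\<close> always comes first, \<open>\<eta>\<close> comes first only on the faces with tangential
  variables \<open>\<eta>\<close> and \<open>\<zeta>\<close>, and \<open>\<zeta>\<close> never does.
\<close>

lemma elem_poly1:
  "(\<Sum>l = 1..20. elem_coeff1 dx dy dz S D l * phi l \<xi> \<eta> \<zeta>) =
     (face_eval (S 1) \<eta> \<zeta> + \<xi> * face_eval (D 1) \<eta> \<zeta>) / 2
     + dx / dy * bubble_fst (D 2) \<xi> \<zeta> + dx / dz * bubble_fst (D 3) \<xi> \<eta>"
proof -
  \<comment> \<open>Opaque names keep the simplifier from spreading the quotients over the monomials.\<close>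
  obtain r s where ratios: "dx / dy = r" "dx / dz = s"
    by blast
  show ?thesis
    unfolding sum_1_20 face_eval_expand bubble_fst_def elem_coeff1_def phi_def ratios radical_inverses
    unfolding sqrt_15
    by (simp add: algebra_simps sqrt_mult_cancel power2_eq_square power3_eq_cube
        add_divide_distrib diff_divide_distrib)
qed

lemma elem_poly2:
  "(\<Sum>l = 1..20. elem_coeff2 dx dy dz S D l * phi l \<xi> \<eta> \<zeta>) =
     (face_eval (S 2) \<xi> \<zeta> + \<eta> * face_eval (D 2) \<xi> \<zeta>) / 2
     + dy / dx * bubble_fst (D 1) \<eta> \<zeta> + dy / dz * bubble_snd (D 3) \<eta>"
proof -
  obtain r s where ratios: "dy / dx = r" "dy / dz = s"
    by blast
  show ?thesis
    unfolding sum_1_20 face_eval_expand bubble_fst_def bubble_snd_def elem_coeff2_def phi_def ratios radical_inverses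
    unfolding sqrt_15
    by (simp add: algebra_simps sqrt_mult_cancel power2_eq_square power3_eq_cube
        add_divide_distrib diff_divide_distrib)
qed

lemma elem_poly3:
  "(\<Sum>l = 1..20. elem_coeff3 dx dy dz S D l * phi l \<xi> \<eta> \<zeta>) =
     (face_eval (S 3) \<xi> \<eta> + \<zeta> * face_eval (D 3) \<xi> \<eta>) / 2
     + dz / dx * bubble_snd (D 1) \<zeta> + dz / dy * bubble_snd (D 2) \<zeta>"
proof -
  obtain r s where ratios: "dz / dx = r" "dz / dy = s"
    by blast
  show ?thesis
    unfolding sum_1_20 face_eval_expand bubble_snd_def elem_coeff3_def phi_def ratios radical_inverses
    unfolding sqrt_15
    by (simp add: algebra_simps sqrt_mult_cancel power2_eq_square power3_eq_cube
        add_divide_distrib diff_divide_distrib)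
qed

text \<open>
  The reason for the choice of the bubbles: together they cancel all of a jump polynomial except its
  mean \<open>c 1\<close>.
\<close>

lemma bubble_deriv_cancel:
  assumes "((\<lambda>a. bubble_fst c a \<beta>) has_real_derivative u) (at \<alpha>)"
    and "(bubble_snd c has_real_derivative v) (at \<beta>)"
  shows "face_eval c \<alpha> \<beta> + 2 * (u + v) = c 1"
proof -
  have "((\<lambda>a. bubble_fst c a \<beta>) has_real_derivative
      - (sqrt 3 * \<alpha> * c 2 + 3 * \<alpha> * \<beta> * c 4 + sqrt 5 / 2 * (3 * \<alpha>^2 - 1) * c 5) / 2) (at \<alpha>)"
    unfolding bubble_fst_def
    by (auto intro!: derivative_eq_intros simp: field_simps power2_eq_square)
  then have u: "u = - (sqrt 3 * \<alpha> * c 2 + 3 * \<alpha> * \<beta> * c 4 + sqrt 5 / 2 * (3 * \<alpha>^2 - 1) * c 5) / 2"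
    using assms(1) DERIV_unique by blast
  have "(bubble_snd c has_real_derivative
      - (sqrt 3 * \<beta> * c 3 + sqrt 5 / 2 * (3 * \<beta>^2 - 1) * c 6) / 2) (at \<beta>)"
    unfolding bubble_snd_def
    by (auto intro!: derivative_eq_intros simp: field_simps power2_eq_square)
  then have v: "v = - (sqrt 3 * \<beta> * c 3 + sqrt 5 / 2 * (3 * \<beta>^2 - 1) * c 6) / 2"
    using assms(2) DERIV_unique by blast
  show ?thesis
    unfolding face_eval_expand u v by (simp add: field_simps)
qed

lemma differentiable_bubble:
  "(\<lambda>a. bubble_fst c a \<beta>) differentiable (at \<alpha>)" "bubble_snd c differentiable (at \<beta>)"
  unfolding bubble_fst_def bubble_snd_def by (auto intro!: derivative_intros)

section \<open>Divergence from partial derivatives\<close>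

text \<open>
  Reduces a divergence to one-variable derivatives, so that in each component only the dependence
  on its normal variable has to be differentiated.
\<close>

lemma divergence_partials:
  fixes F :: "real^'n \<Rightarrow> real^'n"
  assumes "F differentiable (at p)"
    and "\<And>m. ((\<lambda>t. F (p + t *\<^sub>R axis m 1) $ m) has_real_derivative d m) (at 0)"
  shows "divergence F p = (\<Sum>m\<in>UNIV. d m)"
proof -
  have "frechet_derivative F (at p) (axis m 1) $ m = d m" for m
  proof -
    let ?F' = "frechet_derivative F (at p)"
    have F': "(F has_derivative ?F') (at p)"
      using assms(1) frechet_derivative_works by blast
    have line: "((\<lambda>t. p + t *\<^sub>R axis m 1) has_derivative (\<lambda>t. t *\<^sub>R axis m 1)) (at (0::real))"
      by (auto intro!: derivative_eq_intros)
    have "((\<lambda>t. F (p + t *\<^sub>R axis m 1)) has_derivative (\<lambda>t. ?F' (t *\<^sub>R axis m 1))) (at (0::real))"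
      using has_derivative_compose[OF line, of F ?F'] F' by simp
    then have "((\<lambda>t. F (p + t *\<^sub>R axis m 1) $ m) has_derivative (\<lambda>t. ?F' (t *\<^sub>R axis m 1) $ m)) (at 0)"
      by (rule bounded_linear.has_derivative[OF bounded_linear_vec_nth])
    moreover have "(\<lambda>t. ?F' (t *\<^sub>R axis m 1) $ m) = (*) (?F' (axis m 1) $ m)"
      by (simp add: fun_eq_iff linear_cmul[OF has_derivative_linear[OF F']] mult.commute)
    ultimately have "((\<lambda>t. F (p + t *\<^sub>R axis m 1) $ m) has_real_derivative ?F' (axis m 1) $ m) (at 0)"
      by (simp add: has_field_derivative_def)
    then show ?thesis
      using assms(2) DERIV_unique by blast
  qed
  then show ?thesis
    by (simp add: divergence_def)
qed

section \<open>The field of one element\<close>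

lemma local_coord_nth:
  "local_coord dx dy dz orig i j k p $ 1 = (p $ 1 - orig $ 1 - of_int i * dx) / (dx / 2)"
  "local_coord dx dy dz orig i j k p $ 2 = (p $ 2 - orig $ 2 - of_int j * dy) / (dy / 2)"
  "local_coord dx dy dz orig i j k p $ 3 = (p $ 3 - orig $ 3 - of_int k * dz) / (dz / 2)"
  by (simp_all add: local_coord_def center_def Let_def algebra_simps)

lemma local_coord_axis:
  "local_coord dx dy dz orig i j k (p + t *\<^sub>R axis 1 1) =
     local_coord dx dy dz orig i j k p + (2 * t / dx) *\<^sub>R axis 1 1"
  "local_coord dx dy dz orig i j k (p + t *\<^sub>R axis 2 1) =
     local_coord dx dy dz orig i j k p + (2 * t / dy) *\<^sub>R axis 2 1"
  "local_coord dx dy dz orig i j k (p + t *\<^sub>R axis 3 1) =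
     local_coord dx dy dz orig i j k p + (2 * t / dz) *\<^sub>R axis 3 1"
  by (simp_all add: vec_eq_iff forall_3 local_coord_nth axis_def field_simps add_divide_distrib diff_divide_distrib)

context
  fixes dx dy dz :: real and orig :: "real^3" and A Bt :: coeffs and i j k :: int
begin

abbreviation "face_c \<equiv> face_coeff dx dy dz A Bt"
abbreviation "fsum \<equiv> face_sum face_c i j k"
abbreviation "jump \<equiv> face_diff face_c i j k"
abbreviation "loc_of \<equiv> local_coord dx dy dz orig i j k"
abbreviation "field_on \<equiv> elem_field dx dy dz orig A Bt i j k"

lemma elem_field_nth:
  "field_on p $ 1 = (face_eval (fsum 1) (loc_of p $ 2) (loc_of p $ 3)
       + loc_of p $ 1 * face_eval (jump 1) (loc_of p $ 2) (loc_of p $ 3)) / 2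
     + dx / dy * bubble_fst (jump 2) (loc_of p $ 1) (loc_of p $ 3)
     + dx / dz * bubble_fst (jump 3) (loc_of p $ 1) (loc_of p $ 2)"
  "field_on p $ 2 = (face_eval (fsum 2) (loc_of p $ 1) (loc_of p $ 3)
       + loc_of p $ 2 * face_eval (jump 2) (loc_of p $ 1) (loc_of p $ 3)) / 2
     + dy / dx * bubble_fst (jump 1) (loc_of p $ 2) (loc_of p $ 3)
     + dy / dz * bubble_snd (jump 3) (loc_of p $ 2)"
  "field_on p $ 3 = (face_eval (fsum 3) (loc_of p $ 1) (loc_of p $ 2)
       + loc_of p $ 3 * face_eval (jump 3) (loc_of p $ 1) (loc_of p $ 2)) / 2
     + dz / dx * bubble_snd (jump 1) (loc_of p $ 3)
     + dz / dy * bubble_snd (jump 2) (loc_of p $ 3)"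
  by (simp_all only: elem_poly1[symmetric] elem_poly2[symmetric] elem_poly3[symmetric])
    (simp_all add: elem_field_def elem_coeff_def Let_def)

lemma elem_field_differentiable: "field_on differentiable (at p)"
proof -
  have loc: "(\<lambda>p. loc_of p $ m) differentiable (at p)" for m
  proof -
    have nth: "(\<lambda>p. p $ n) differentiable (at (p :: real^3))" for n :: 3
      by (intro bounded_linear_imp_differentiable bounded_linear_vec_nth)
    have affine: "(\<lambda>p. (p $ n - a - c) / h) differentiable (at (p :: real^3))" for n :: 3 and a c h :: real
      using nth by (simp add: divide_inverse)
    show ?thesis
      using exhaust_3[of m] by (elim disjE; simp only: local_coord_nth affine)
  qed
  have "(\<lambda>p. field_on p $ m) differentiable (at p)" for m
    using exhaust_3[of m]
    by (elim disjE; simp only: elem_field_nth face_eval_expand bubble_fst_def bubble_snd_def)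
      (intro loc differentiable_const differentiable_add differentiable_diff differentiable_mult
        differentiable_power differentiable_divide; simp)+
  then have "\<forall>e\<in>Basis. (\<lambda>p. field_on p \<bullet> e) differentiable (at p)"
    by (auto simp: Basis_vec_def inner_axis)
  then show ?thesis
    by (simp add: differentiable_componentwise_within[of field_on])
qed

text \<open>
  The bubbles vanish on the faces, and half of sum plus jump, or sum minus jump, is the coefficient
  on one of the two faces.
\<close>

lemma trace_right:
  "loc_of p $ 1 = 1 \<Longrightarrow> field_on p $ 1 = face_eval (\<lambda>l. face_c 1 l (i + 1) j k) (loc_of p $ 2) (loc_of p $ 3)"
  "loc_of p $ 2 = 1 \<Longrightarrow> field_on p $ 2 = face_eval (\<lambda>l. face_c 2 l i (j + 1) k) (loc_of p $ 1) (loc_of p $ 3)"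
  "loc_of p $ 3 = 1 \<Longrightarrow> field_on p $ 3 = face_eval (\<lambda>l. face_c 3 l i j (k + 1)) (loc_of p $ 1) (loc_of p $ 2)"
  by (simp_all add: elem_field_nth bubble_fst_def bubble_snd_def face_eval_def face_sum_def
      face_diff_def sum.distrib[symmetric] sum_divide_distrib algebra_simps)

lemma trace_left:
  "loc_of p $ 1 = - 1 \<Longrightarrow> field_on p $ 1 = face_eval (\<lambda>l. face_c 1 l i j k) (loc_of p $ 2) (loc_of p $ 3)"
  "loc_of p $ 2 = - 1 \<Longrightarrow> field_on p $ 2 = face_eval (\<lambda>l. face_c 2 l i j k) (loc_of p $ 1) (loc_of p $ 3)"
  "loc_of p $ 3 = - 1 \<Longrightarrow> field_on p $ 3 = face_eval (\<lambda>l. face_c 3 l i j k) (loc_of p $ 1) (loc_of p $ 2)"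
  by (simp_all add: elem_field_nth bubble_fst_def bubble_snd_def face_eval_def face_sum_def
      face_diff_def sum_subtractf[symmetric] sum_divide_distrib algebra_simps)

text \<open>
  The three partial derivatives are regrouped by the face direction of the jump they come from; in
  each group \<open>bubble_deriv_cancel\<close> applies.
\<close>

lemma divergence_elem_field:
  assumes "dx > 0" "dy > 0" "dz > 0"
  shows "divergence field_on p = jump 1 1 / dx + jump 2 1 / dy + jump 3 1 / dz"
proof -
  define q where "q = loc_of p"
  define u where "u c \<alpha> \<beta> = deriv (\<lambda>a. bubble_fst c a \<beta>) \<alpha>" for c \<alpha> \<beta>
  define v where "v c = deriv (bubble_snd c)" for c
  have bub: "((\<lambda>a. bubble_fst c a \<beta>) has_real_derivative u c \<alpha> \<beta>) (at \<alpha>)"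
    "(bubble_snd c has_real_derivative v c \<beta>) (at \<beta>)" for c \<alpha> \<beta>
    unfolding u_def v_def
    by (simp_all add: DERIV_deriv_iff_real_differentiable differentiable_bubble)
  have u: "((\<lambda>t. bubble_fst c (\<alpha> + 2 * t / h) \<beta>) has_real_derivative u c \<alpha> \<beta> * (2 / h)) (at 0)"
    if "h > 0" for c \<alpha> \<beta> h
    using that by (intro DERIV_chain2[of "\<lambda>a. bubble_fst c a \<beta>"]) (auto intro!: derivative_eq_intros bub)
  have v: "((\<lambda>t. bubble_snd c (\<beta> + 2 * t / h)) has_real_derivative v c \<beta> * (2 / h)) (at 0)"
    if "h > 0" for c \<beta> h
    using that by (intro DERIV_chain2[of "bubble_snd c"]) (auto intro!: derivative_eq_intros bub)
  define d where "d m =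
    (if m = 1 then face_eval (jump 1) (q $ 2) (q $ 3) / dx
        + 2 * u (jump 2) (q $ 1) (q $ 3) / dy + 2 * u (jump 3) (q $ 1) (q $ 2) / dz
     else if m = 2 then face_eval (jump 2) (q $ 1) (q $ 3) / dy
        + 2 * u (jump 1) (q $ 2) (q $ 3) / dx + 2 * v (jump 3) (q $ 2) / dz
     else face_eval (jump 3) (q $ 1) (q $ 2) / dz
        + 2 * v (jump 1) (q $ 3) / dx + 2 * v (jump 2) (q $ 3) / dy)" for m :: 3
  have interpolant: "((\<lambda>t. (a + (x + 2 * t / h) * c) / 2) has_real_derivative c / h) (at 0)"
    if "h > 0" for a x c h :: real
    using that by (auto intro!: derivative_eq_intros)
  have axis_nth: "axis m (1 :: real) $ n = (if n = m then 1 else 0)" for m n :: 3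
    by (simp add: axis_def)
  note line = elem_field_nth local_coord_axis q_def[symmetric] vector_add_component
    vector_scaleR_component axis_nth
  have "((\<lambda>t. field_on (p + t *\<^sub>R axis 1 1) $ 1) has_real_derivative d 1) (at 0)"
    using DERIV_add[OF DERIV_add[OF interpolant DERIV_cmult[OF u]] DERIV_cmult[OF u],
        of dx dx dx "face_eval (fsum 1) (q $ 2) (q $ 3)" "q $ 1" "face_eval (jump 1) (q $ 2) (q $ 3)"
          "dx / dy" "jump 2" "q $ 1" "q $ 3" "dx / dz" "jump 3" "q $ 1" "q $ 2"] assms
    by (simp add: line d_def mult.commute)
  moreover have "((\<lambda>t. field_on (p + t *\<^sub>R axis 2 1) $ 2) has_real_derivative d 2) (at 0)"
    using DERIV_add[OF DERIV_add[OF interpolant DERIV_cmult[OF u]] DERIV_cmult[OF v],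
        of dy dy dy "face_eval (fsum 2) (q $ 1) (q $ 3)" "q $ 2" "face_eval (jump 2) (q $ 1) (q $ 3)"
          "dy / dx" "jump 1" "q $ 2" "q $ 3" "dy / dz" "jump 3" "q $ 2"] assms
    by (simp add: line d_def mult.commute)
  moreover have "((\<lambda>t. field_on (p + t *\<^sub>R axis 3 1) $ 3) has_real_derivative d 3) (at 0)"
    using DERIV_add[OF DERIV_add[OF interpolant DERIV_cmult[OF v]] DERIV_cmult[OF v],
        of dz dz dz "face_eval (fsum 3) (q $ 1) (q $ 2)" "q $ 3" "face_eval (jump 3) (q $ 1) (q $ 2)"
          "dz / dx" "jump 1" "q $ 3" "dz / dy" "jump 2" "q $ 3"] assms
    by (simp add: line d_def mult.commute)
  ultimately have "((\<lambda>t. field_on (p + t *\<^sub>R axis m 1) $ m) has_real_derivative d m) (at 0)" for m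
    using exhaust_3[of m] by blast
  then have "divergence field_on p = d 1 + d 2 + d 3"
    using divergence_partials[OF elem_field_differentiable] by (simp add: sum_3)
  also have "\<dots> = (face_eval (jump 1) (q $ 2) (q $ 3) + 2 * (u (jump 1) (q $ 2) (q $ 3) + v (jump 1) (q $ 3))) / dx
    + (face_eval (jump 2) (q $ 1) (q $ 3) + 2 * (u (jump 2) (q $ 1) (q $ 3) + v (jump 2) (q $ 3))) / dy
    + (face_eval (jump 3) (q $ 1) (q $ 2) + 2 * (u (jump 3) (q $ 1) (q $ 2) + v (jump 3) (q $ 2))) / dz"
    by (simp add: d_def add_divide_distrib algebra_simps)
  also have "\<dots> = jump 1 1 / dx + jump 2 1 / dy + jump 3 1 / dz"
    by (simp only: bubble_deriv_cancel[OF bub])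
  finally show ?thesis .
qed

end

section \<open>Zero flux and shared faces\<close>

text \<open>
  A discrete form of \<open>div curl = 0\<close>: each of the twelve edge potentials of the element appears twice,
  with opposite signs and the same weight \<open>1 / (h * h')\<close>, where \<open>h\<close> and \<open>h'\<close> are the widths in the two
  directions orthogonal to the edge.
\<close>

lemma face_mean_flux_zero:
  "(face_coeff dx dy dz A Bt 1 1 (i + 1) j k - face_coeff dx dy dz A Bt 1 1 i j k) / dx
       + (face_coeff dx dy dz A Bt 2 1 i (j + 1) k - face_coeff dx dy dz A Bt 2 1 i j k) / dy
       + (face_coeff dx dy dz A Bt 3 1 i j (k + 1) - face_coeff dx dy dz A Bt 3 1 i j k) / dz = 0"
  by (simp add: face_coeff_def face_coeff1_def face_coeff2_def face_coeff3_def
      diff_divide_distrib add_divide_distrib mult.commute)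

lemma mem_element_local_coord:
  assumes "dx > 0" "dy > 0" "dz > 0" and "p \<in> element dx dy dz orig i j k"
  shows "\<bar>local_coord dx dy dz orig i j k p $ m\<bar> \<le> 1"
  using assms exhaust_3[of m]
  by (auto simp: element_def center_def mem_box_cart forall_3 local_coord_nth field_simps abs_le_iff)

text \<open>
  The local coordinates of a point in two neighbouring elements differ by the full length 2 of the
  reference interval, and both lie in \<open>[-1, 1]\<close>.
\<close>

lemma local_coord_shared_face:
  assumes pos: "dx > 0" "dy > 0" "dz > 0"
  shows "p \<in> element dx dy dz orig (i - 1) j k \<inter> element dx dy dz orig i j k \<Longrightarrow>
      local_coord dx dy dz orig i j k p $ 1 = - 1 \<and> local_coord dx dy dz orig (i - 1) j k p $ 1 = 1"
    and "p \<in> element dx dy dz orig i (j - 1) k \<inter> element dx dy dz orig i j k \<Longrightarrow>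
      local_coord dx dy dz orig i j k p $ 2 = - 1 \<and> local_coord dx dy dz orig i (j - 1) k p $ 2 = 1"
    and "p \<in> element dx dy dz orig i j (k - 1) \<inter> element dx dy dz orig i j k \<Longrightarrow>
      local_coord dx dy dz orig i j k p $ 3 = - 1 \<and> local_coord dx dy dz orig i j (k - 1) p $ 3 = 1"
proof -
  have shift: "local_coord dx dy dz orig (i - 1) j k p $ 1 = local_coord dx dy dz orig i j k p $ 1 + 2"
    "local_coord dx dy dz orig i (j - 1) k p $ 2 = local_coord dx dy dz orig i j k p $ 2 + 2"
    "local_coord dx dy dz orig i j (k - 1) p $ 3 = local_coord dx dy dz orig i j k p $ 3 + 2"
    using pos by (simp_all add: local_coord_nth field_simps)
  note bound = mem_element_local_coord[OF pos]
  show "p \<in> element dx dy dz orig (i - 1) j k \<inter> element dx dy dz orig i j k \<Longrightarrow>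
      local_coord dx dy dz orig i j k p $ 1 = - 1 \<and> local_coord dx dy dz orig (i - 1) j k p $ 1 = 1"
    using bound[of p orig i j k 1] bound[of p orig "i - 1" j k 1] shift by auto
  show "p \<in> element dx dy dz orig i (j - 1) k \<inter> element dx dy dz orig i j k \<Longrightarrow>
      local_coord dx dy dz orig i j k p $ 2 = - 1 \<and> local_coord dx dy dz orig i (j - 1) k p $ 2 = 1"
    using bound[of p orig i j k 2] bound[of p orig i "j - 1" k 2] shift by auto
  show "p \<in> element dx dy dz orig i j (k - 1) \<inter> element dx dy dz orig i j k \<Longrightarrow>
      local_coord dx dy dz orig i j k p $ 3 = - 1 \<and> local_coord dx dy dz orig i j (k - 1) p $ 3 = 1"
    using bound[of p orig i j k 3] bound[of p orig i j "k - 1" 3] shift by auto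
qed

theorem mainTheorem2:
  fixes dx dy dz :: real
    and orig :: "real^3"
    and Bt A :: "3 \<Rightarrow> nat \<Rightarrow> int \<Rightarrow> int \<Rightarrow> int \<Rightarrow> real"
  assumes "dx > 0" and "dy > 0" and "dz > 0"
  defines "T \<equiv> element dx dy dz orig"
    and "b \<equiv> face_coeff dx dy dz A Bt"
    and "bpoly \<equiv> face_poly dx dy dz orig A Bt"
    and "B \<equiv> elem_field dx dy dz orig A Bt"
  shows "(\<forall>i j k. \<forall>p\<in>T i j k. B i j k differentiable (at p) \<and>
            divergence (B i j k) p =
              (b 1 1 (i + 1) j k - b 1 1 i j k) / dx
            + (b 2 1 i (j + 1) k - b 2 1 i j k) / dy
            + (b 3 1 i j (k + 1) - b 3 1 i j k) / dz)
       \<and> (\<forall>i j k. (b 1 1 (i + 1) j k - b 1 1 i j k) / dx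
                + (b 2 1 i (j + 1) k - b 2 1 i j k) / dy
                + (b 3 1 i j (k + 1) - b 3 1 i j k) / dz = 0)
       \<and> (\<forall>i j k. \<forall>p\<in>T (i - 1) j k \<inter> T i j k.
            B (i - 1) j k p $ 1 = bpoly 1 i j k p \<and> B i j k p $ 1 = bpoly 1 i j k p)
       \<and> (\<forall>i j k. \<forall>p\<in>T i (j - 1) k \<inter> T i j k.
            B i (j - 1) k p $ 2 = bpoly 2 i j k p \<and> B i j k p $ 2 = bpoly 2 i j k p)
       \<and> (\<forall>i j k. \<forall>p\<in>T i j (k - 1) \<inter> T i j k.
            B i j (k - 1) p $ 3 = bpoly 3 i j k p \<and> B i j k p $ 3 = bpoly 3 i j k p)
       \<and> globally_divergence_free T B"
proof -
  note pos = assms(1-3)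
  have div: "B i j k differentiable (at p) \<and> divergence (B i j k) p =
              (b 1 1 (i + 1) j k - b 1 1 i j k) / dx
            + (b 2 1 i (j + 1) k - b 2 1 i j k) / dy
            + (b 3 1 i j (k + 1) - b 3 1 i j k) / dz" for i j k p
    unfolding B_def b_def
    using divergence_elem_field[OF pos] elem_field_differentiable by (simp add: face_diff_def)
  have zero: "(b 1 1 (i + 1) j k - b 1 1 i j k) / dx
            + (b 2 1 i (j + 1) k - b 2 1 i j k) / dy
            + (b 3 1 i j (k + 1) - b 3 1 i j k) / dz = 0" for i j k
    unfolding b_def by (rule face_mean_flux_zero)
  have face: "bpoly 1 i j k p = face_eval (\<lambda>l. b 1 l i j k)
      (local_coord dx dy dz orig i j k p $ 2) (local_coord dx dy dz orig i j k p $ 3)"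
    "bpoly 2 i j k p = face_eval (\<lambda>l. b 2 l i j k)
      (local_coord dx dy dz orig i j k p $ 1) (local_coord dx dy dz orig i j k p $ 3)"
    "bpoly 3 i j k p = face_eval (\<lambda>l. b 3 l i j k)
      (local_coord dx dy dz orig i j k p $ 1) (local_coord dx dy dz orig i j k p $ 2)" for i j k p
    by (simp_all add: bpoly_def b_def face_poly_def face_eval_def Let_def)
  have tr1: "B (i - 1) j k p $ 1 = bpoly 1 i j k p \<and> B i j k p $ 1 = bpoly 1 i j k p"
    if "p \<in> T (i - 1) j k \<inter> T i j k" for i j k p
    using local_coord_shared_face(1)[OF pos that[unfolded T_def]]
    by (simp add: B_def b_def face trace_left trace_right local_coord_nth(2,3))
  have tr2: "B i (j - 1) k p $ 2 = bpoly 2 i j k p \<and> B i j k p $ 2 = bpoly 2 i j k p"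
    if "p \<in> T i (j - 1) k \<inter> T i j k" for i j k p
    using local_coord_shared_face(2)[OF pos that[unfolded T_def]]
    by (simp add: B_def b_def face trace_left trace_right local_coord_nth(1,3))
  have tr3: "B i j (k - 1) p $ 3 = bpoly 3 i j k p \<and> B i j k p $ 3 = bpoly 3 i j k p"
    if "p \<in> T i j (k - 1) \<inter> T i j k" for i j k p
    using local_coord_shared_face(3)[OF pos that[unfolded T_def]]
    by (simp add: B_def b_def face trace_left trace_right local_coord_nth(1,2))
  show ?thesis
    unfolding globally_divergence_free_def using div zero tr1 tr2 tr3 by simp
qed

end
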